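(* Let $\mathbf{a}\in\mathbb{R}^{n_{\mathrm e}}_{\ge 0}$, $\omega\in\mathbb{R}_{>0}$, $\mathbf{f}_{\mathrm A}\in\mathbb{R}^{n_{\mathrm{dof}}}$ and $\overline{d}\in\mathbb{R}$. The following statements are equivalent: (1) $\mathbf{f}_{\mathrm A}^{\mathsf T}\big[\mathbf{K}(\mathbf{a})-\omega^2\mathbf{M}(\mathbf{a})\big]^{\dagger}\mathbf{f}_{\mathrm A}\le\overline{d}$, $\ \mathbf{f}_{\mathrm A}\in\mathcal{R}\big(\mathbf{K}(\mathbf{a})-\omega^2\mathbf{M}(\mathbf{a})\big)$, $\ \overline{d}>0$, and $\ \mathbf{K}(\mathbf{a})-\omega^2\mathbf{M}(\mathbf{a})\succeq \mathbf{0}$; (2) $\begin{pmatrix}\overline{d} & -\mathbf{f}_{\mathrm A}^{\mathsf T}\\ -\mathbf{f}_{\mathrm A} & \mathbf{K}(\mathbf{a})-\omega^2\mathbf{M}(\mathbf{a})\end{pmatrix}\succeq \mathbf{0}$.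
   Context: For $\mathbf{a}\in\mathbb{R}^{n_{\mathrm e}}_{\ge 0}$ the stiffness and mass matrices are $\mathbf{K}(\mathbf{a})=\sum_{e=1}^{n_{\mathrm e}}\big[a_e\mathbf{K}^{(1)}_e+a_e^2\mathbf{K}^{(2)}_e+a_e^3\mathbf{K}^{(3)}_e\big]$ and $\mathbf{M}(\mathbf{a})=\mathbf{M}^{(0)}+\sum_{e=1}^{n_{\mathrm e}}a_e\mathbf{M}^{(1)}_e$, where all $\mathbf{K}^{(i)}_e$, $\mathbf{M}^{(0)}$, $\mathbf{M}^{(1)}_e$ are fixed real symmetric positive semidefinite $n_{\mathrm{dof}}\times n_{\mathrm{dof}}$ matrices. The number $\omega$ is the angular frequency of a harmonic load with amplitude vector $\mathbf{f}_{\mathrm A}$, and $\overline{d}$ is the upper bound on the dynamic compliance. $\mathbf{A}\succeq\mathbf{0}$ means that the real symmetric matrix $\mathbf{A}$ is positive semidefinite, $\mathcal{R}(\cdot)$ is the range (column space), and $(\cdot)^{\dagger}$ is the Moore-Penrose pseudoinverse.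
   Formalization: The formal theorem additionally assumes that the load amplitude f_A and the bound d are not both zero; if f_A = 0, d = 0 and K(a) − ω²M(a) is positive semidefinite, (2) holds while (1) fails because it requires d > 0. *)

theory Defs
  imports "HOL-Analysis.Analysis"
begin

definition psd :: "real^'n^'n \<Rightarrow> bool" where
  "psd A \<longleftrightarrow> transpose A = A \<and> (\<forall>x. 0 \<le> x \<bullet> (A *v x))"

text \<open>The Moore-Penrose pseudoinverse is characterised by the four Penrose equations; a matrix
  satisfying them exists and is unique for every real matrix.\<close>

definition is_pseudoinverse :: "real^'n^'m \<Rightarrow> real^'m^'n \<Rightarrow> bool" where
  "is_pseudoinverse A X \<longleftrightarrow>
     A ** X ** A = A \<and>
     X ** A ** X = X \<and>
     transpose (A ** X) = A ** X \<and>
     transpose (X ** A) = X ** A"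

definition pseudoinverse :: "real^'n^'m \<Rightarrow> real^'m^'n" where
  "pseudoinverse A = (THE X. is_pseudoinverse A X)"

definition block_matrix ::
  "real^'p^'m \<Rightarrow> real^'q^'m \<Rightarrow> real^'p^'n \<Rightarrow> real^'q^'n \<Rightarrow> real^('p + 'q)^('m + 'n)" where
  "block_matrix A B C D = (\<chi> i j.
     case i of
       Inl k \<Rightarrow> (case j of Inl l \<Rightarrow> A $ k $ l | Inr l \<Rightarrow> B $ k $ l)
     | Inr k \<Rightarrow> (case j of Inl l \<Rightarrow> C $ k $ l | Inr l \<Rightarrow> D $ k $ l))"

text \<open>In the following, the elements are indexed by \<open>'e\<close> and the degrees of freedom by \<open>'n\<close>.\<close>

definition stiffness ::
  "('e::finite \<Rightarrow> real^'n^'n) \<Rightarrow> ('e \<Rightarrow> real^'n^'n) \<Rightarrow> ('e \<Rightarrow> real^'n^'n) \<Rightarrow> real^'e \<Rightarrow> real^'n^'n" where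
  "stiffness K1 K2 K3 a =
     (\<Sum>e\<in>UNIV. (a $ e) *\<^sub>R K1 e + (a $ e)\<^sup>2 *\<^sub>R K2 e + (a $ e)^3 *\<^sub>R K3 e)"

definition mass :: "real^'n^'n \<Rightarrow> ('e::finite \<Rightarrow> real^'n^'n) \<Rightarrow> real^'e \<Rightarrow> real^'n^'n" where
  "mass M0 M1 a = M0 + (\<Sum>e\<in>UNIV. (a $ e) *\<^sub>R M1 e)"

definition dynamic_stiffness ::
  "('e::finite \<Rightarrow> real^'n^'n) \<Rightarrow> ('e \<Rightarrow> real^'n^'n) \<Rightarrow> ('e \<Rightarrow> real^'n^'n) \<Rightarrow>
   real^'n^'n \<Rightarrow> ('e \<Rightarrow> real^'n^'n) \<Rightarrow> real \<Rightarrow> real^'e \<Rightarrow> real^'n^'n" where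
  "dynamic_stiffness K1 K2 K3 M0 M1 \<omega> a = stiffness K1 K2 K3 a - \<omega>\<^sup>2 *\<^sub>R mass M0 M1 a"

end

theory Submission
  imports Defs
begin

text \<open>
  Write \<open>A\<close> for the symmetric matrix \<open>K(a) - \<omega>\<^sup>2 M(a)\<close>; the equivalence is the
  Schur complement criterion for \<open>A\<close> and a scalar corner entry. The quadratic form of the block matrix at
  \<open>(t, x)\<close> is \<open>d t\<^sup>2 - 2 t (f \<bullet> x) + x \<bullet> A x\<close>.

  If \<open>f = A u\<close>, completing the square turns this form into \<open>(d - u \<bullet> A u) t\<^sup>2 + (x -
  t u) \<bullet> A (x - t u)\<close>, and \<open>u \<bullet> A u = f \<bullet> A\<^sup>\<dagger> f\<close> because
  \<open>A A\<^sup>\<dagger> A = A\<close>. This is nonnegative if \<open>A\<close> is positive semidefinite and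
  \<open>f \<bullet> A\<^sup>\<dagger> f \<le> d\<close>. In the other direction, the form at \<open>(0, x)\<close>
  shows that \<open>A\<close> is positive semidefinite. At \<open>(1, s y)\<close> with \<open>A y = 0\<close> it is
  affine in \<open>s\<close>, so \<open>f\<close> is orthogonal to \<open>ker A\<close>, hence in the range of
  \<open>A\<close>, and the point \<open>(1, A\<^sup>\<dagger> f)\<close> gives the compliance bound; see
  \<open>pseudoinverse_solves\<close> and \<open>psd_bordered_iff_pseudoinverse\<close>. A corner entry \<open>d =
  0\<close> would make the form linear in \<open>t\<close>, forcing \<open>f = 0\<close>; so \<open>d > 0\<close>
  holds as soon as \<open>f\<close> and \<open>d\<close> do not both vanish.

  The equations for \<open>A\<^sup>\<dagger>\<close> are available only once the pseudoinverse is known to exist and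
  to be unique (\<open>ex_is_pseudoinverse\<close>, \<open>is_pseudoinverse_unique\<close>). Existence follows from
  Zlobec's formula \<open>A\<^sup>\<dagger> = A\<^sup>T (A\<^sup>T A A\<^sup>T)\<^sup>- A\<^sup>T\<close>, in which
  \<open>B\<^sup>-\<close> is any matrix with \<open>B B\<^sup>- B = B\<close>; it needs no spectral or singular value
  decomposition, only the fact that \<open>A\<^sup>T A y = 0\<close> implies \<open>A y = 0\<close>.
\<close>

section \<open>The Moore-Penrose pseudoinverse\<close>

lemma ex_generalized_inverse:
  fixes A :: "real^'n^'m"
  obtains G :: "real^'m^'n" where "A ** G ** A = A"
proof -
  obtain g where g: "linear g" "\<forall>v\<in>(*v) A ` UNIV. A *v g v = v"
    using linear_exists_right_inverse_on[OF matrix_vector_mul_linear[of A] subspace_UNIV]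
    by auto
  have "A ** matrix g ** A = A"
    using g by (simp add: matrix_eq matrix_vector_mul_assoc[symmetric])
  then show ?thesis by (rule that)
qed

text \<open>If \<open>A\<^sup>T A w = 0\<close> then \<open>A w = 0\<close>, because \<open>w \<bullet> A\<^sup>T A w = A w \<bullet> A w\<close>; apply this to \<open>w = (Y - Z) x\<close>.\<close>

lemma transpose_mult_cancel_left:
  fixes A :: "real^'n^'m" and Y Z :: "real^'k^'n"
  assumes "transpose A ** (A ** Y) = transpose A ** (A ** Z)"
  shows "A ** Y = A ** Z"
proof -
  have "A *v (Y *v x) = A *v (Z *v x)" for x
  proof -
    define w where "w = Y *v x - Z *v x"
    have "transpose A *v (A *v (Y *v x)) = transpose A *v (A *v (Z *v x))"
      using arg_cong[OF assms, of "\<lambda>M. M *v x"] by (simp only: matrix_vector_mul_assoc[symmetric])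
    then have "transpose A *v (A *v w) = 0"
      by (simp add: w_def matrix_vector_mult_diff_distrib)
    then have "(A *v w) \<bullet> (A *v w) = 0"
      by (metis dot_lmul_matrix inner_zero_left transpose_matrix_vector)
    then show ?thesis
      by (simp add: w_def matrix_vector_mult_diff_distrib)
  qed
  then show ?thesis
    by (simp add: matrix_eq matrix_vector_mul_assoc[symmetric])
qed

text \<open>One half of Zlobec's formula: two cancellations in \<open>B G B = B\<close>, where \<open>B = A\<^sup>T A A\<^sup>T\<close>. The mirror
  image \<open>A\<^sup>T A X = A\<^sup>T\<close> is the transpose of the same statement for \<open>A\<^sup>T\<close> and \<open>G\<^sup>T\<close>.\<close>

lemma zlobec_absorb:
  fixes A G :: "real^'n^'m"
  defines "B \<equiv> transpose A ** A ** transpose A"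
  assumes "B ** G ** B = B"
  shows "transpose A ** G ** transpose A ** A ** transpose A = transpose A"
proof -
  have "transpose A ** (A ** (transpose A ** G ** B)) = transpose A ** (A ** transpose A)"
    using assms(2) by (simp add: B_def matrix_mul_assoc)
  then have "A ** (transpose A ** G ** B) = A ** transpose A"
    by (rule transpose_mult_cancel_left)
  then have "transpose (transpose A) ** (transpose A ** (G ** B))
           = transpose (transpose A) ** (transpose A ** mat 1)"
    by (simp add: matrix_mul_assoc)
  then have "transpose A ** (G ** B) = transpose A ** mat 1"
    by (rule transpose_mult_cancel_left)
  then show ?thesis by (simp add: B_def matrix_mul_assoc)
qed

text \<open>A matrix \<open>P\<close> with \<open>P P\<^sup>T = P\<close> is symmetric, since \<open>P P\<^sup>T\<close> is; with the absorption laws this shows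
  that \<open>X A\<close> and \<open>A X\<close> are orthogonal projections.\<close>

lemma ex_is_pseudoinverse:
  fixes A :: "real^'n^'m"
  shows "\<exists>X. is_pseudoinverse A X"
proof -
  define B where "B = transpose A ** A ** transpose A"
  obtain G where G: "B ** G ** B = B" by (rule ex_generalized_inverse)
  define X where "X = transpose A ** G ** transpose A"
  have l: "X ** A ** transpose A = transpose A"
    using zlobec_absorb[of A G] G by (simp add: X_def B_def)
  have "transpose (B ** G ** B) = transpose B" using G by simp
  then have "A ** transpose G ** A ** transpose A ** A = A"
    using zlobec_absorb[of "transpose A" "transpose G"]
    by (simp add: B_def matrix_transpose_mul matrix_mul_assoc)
  then have "transpose (A ** transpose G ** A ** transpose A ** A) = transpose A"
    by simp
  then have r: "transpose A ** A ** X = transpose A"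
    by (simp add: X_def matrix_transpose_mul matrix_mul_assoc)
  have l': "A ** transpose (X ** A) = A"
    using arg_cong[OF l, of transpose] by (simp add: matrix_transpose_mul matrix_mul_assoc)
  have r': "transpose (A ** X) ** A = A"
    using arg_cong[OF r, of transpose] by (simp add: matrix_transpose_mul matrix_mul_assoc)
  have "(X ** A) ** transpose (X ** A) = X ** A"
    using l' by (metis matrix_mul_assoc)
  then have sl: "transpose (X ** A) = X ** A"
    by (metis matrix_transpose_mul transpose_transpose)
  have "transpose (A ** X) ** (A ** X) = A ** X"
    using r' by (metis matrix_mul_assoc)
  then have sr: "transpose (A ** X) = A ** X"
    by (metis matrix_transpose_mul transpose_transpose)
  have "A ** X ** A = A" using r' sr by simp
  moreover have "X ** A ** X = X"
    using l by (metis X_def matrix_mul_assoc)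
  ultimately show ?thesis
    using sl sr unfolding is_pseudoinverse_def by blast
qed

text \<open>\<open>A X\<close> and \<open>A Y\<close> are both the orthogonal projection onto the range of \<open>A\<close>, and \<open>X A\<close> and \<open>Y A\<close> the
  one onto the range of \<open>A\<^sup>T\<close>; then \<open>X = X A X = X A Y = Y A Y = Y\<close>.\<close>

lemma is_pseudoinverse_unique:
  assumes "is_pseudoinverse A X" and "is_pseudoinverse A Y"
  shows "X = Y"
proof -
  note X = assms(1)[unfolded is_pseudoinverse_def] and Y = assms(2)[unfolded is_pseudoinverse_def]
  have "A ** X = (A ** Y) ** (A ** X)" using Y by (simp add: matrix_mul_assoc)
  then have "transpose (A ** X) = transpose (A ** X) ** transpose (A ** Y)"
    by (metis matrix_transpose_mul)
  then have AX: "A ** X = A ** Y" using X Y by (simp add: matrix_mul_assoc)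
  have "X ** A = (X ** A) ** (Y ** A)" using Y by (metis matrix_mul_assoc)
  then have "transpose (X ** A) = transpose (Y ** A) ** transpose (X ** A)"
    by (metis matrix_transpose_mul)
  then have XA: "X ** A = Y ** A" using X Y by (metis matrix_mul_assoc)
  show ?thesis using AX XA X Y by (metis matrix_mul_assoc)
qed

lemma is_pseudoinverse_pseudoinverse: "is_pseudoinverse A (pseudoinverse A)"
  unfolding pseudoinverse_def
  using ex_is_pseudoinverse is_pseudoinverse_unique by (metis theI)

lemma inner_symmetric_matrix:
  fixes A :: "real^'n^'n"
  assumes "transpose A = A"
  shows "x \<bullet> (A *v y) = (A *v x) \<bullet> y"
  using assms by (metis dot_lmul_matrix transpose_matrix_vector)

text \<open>The residual \<open>w = f - A A\<^sup>\<dagger> f\<close> lies in the kernel of \<open>A\<close>, so it is orthogonal to \<open>f\<close> by hypothesis and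
  to \<open>A A\<^sup>\<dagger> f\<close> by symmetry, hence to itself.\<close>

lemma pseudoinverse_solves:
  fixes A :: "real^'n^'n"
  assumes sym: "transpose A = A" and orth: "\<And>x. A *v x = 0 \<Longrightarrow> f \<bullet> x = 0"
  shows "A *v (pseudoinverse A *v f) = f"
proof -
  define X where "X = pseudoinverse A"
  have X: "A ** X ** A = A" "transpose (A ** X) = A ** X"
    using is_pseudoinverse_pseudoinverse[of A] by (auto simp: X_def is_pseudoinverse_def)
  define w where "w = f - A *v (X *v f)"
  have "transpose (A ** X ** A) = A" using X(1) sym by simp
  then have "A ** (A ** X) = A"
    using X(2) sym by (metis matrix_transpose_mul)
  then have "A *v (A *v (X *v f)) = A *v f"
    by (simp add: matrix_vector_mul_assoc)
  then have w: "A *v w = 0"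
    by (simp add: w_def matrix_vector_mult_diff_distrib)
  have "w \<bullet> (A *v (X *v f)) = 0"
    using w by (simp add: inner_symmetric_matrix[OF sym])
  moreover have "w \<bullet> f = 0" using orth[OF w] by (simp add: inner_commute)
  ultimately have "w \<bullet> w = 0" by (subst (2) w_def) (simp add: inner_diff_right)
  then show ?thesis by (simp add: w_def X_def)
qed

section \<open>The quadratic form of a bordered matrix\<close>

definition block_vector :: "real^'m \<Rightarrow> real^'n \<Rightarrow> real^('m + 'n)" where
  "block_vector u v = (\<chi> i. case i of Inl k \<Rightarrow> u $ k | Inr k \<Rightarrow> v $ k)"

lemma sum_UNIV_Plus:
  "(\<Sum>i\<in>(UNIV :: ('a::finite + 'b::finite) set). g i) = (\<Sum>i\<in>UNIV. g (Inl i)) + (\<Sum>i\<in>UNIV. g (Inr i))"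
  by (simp add: UNIV_Plus_UNIV[symmetric] sum.Plus del: UNIV_Plus_UNIV)

lemma block_vector_cases:
  obtains u v where "z = block_vector u v"
proof
  show "z = block_vector (\<chi> i. z $ Inl i) (\<chi> i. z $ Inr i)"
    by (auto simp: block_vector_def vec_eq_iff split: sum.split)
qed

lemma inner_block_vector:
  "block_vector u v \<bullet> block_vector u' v' = u \<bullet> u' + v \<bullet> v'"
  by (simp add: inner_vec_def block_vector_def sum_UNIV_Plus)

lemma block_matrix_mult_block_vector:
  "block_matrix A B C D *v block_vector u v = block_vector (A *v u + B *v v) (C *v u + D *v v)"
  by (auto simp: vec_eq_iff block_matrix_def block_vector_def matrix_vector_mult_def sum_UNIV_Plus
      split: sum.split)

lemma transpose_block_matrix:
  "transpose (block_matrix A B C D)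
     = block_matrix (transpose A) (transpose C) (transpose B) (transpose D)"
  by (auto simp: vec_eq_iff block_matrix_def transpose_def split: sum.split)

lemma block_matrix_eq_iff:
  "block_matrix A B C D = block_matrix A' B' C' D' \<longleftrightarrow> A = A' \<and> B = B' \<and> C = C' \<and> D = D'"
proof
  assume "block_matrix A B C D = block_matrix A' B' C' D'"
  then have eq: "block_matrix A B C D $ i $ j = block_matrix A' B' C' D' $ i $ j" for i j
    by simp
  show "A = A' \<and> B = B' \<and> C = C' \<and> D = D'"
    using eq[of "Inl _" "Inl _"] eq[of "Inl _" "Inr _"] eq[of "Inr _" "Inl _"] eq[of "Inr _" "Inr _"]
    by (simp add: vec_eq_iff block_matrix_def)
qed simp

lemma psd_bordered_iff:
  fixes A :: "real^'n^'n" and f :: "real^'n" and d :: real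
  shows "psd (block_matrix (mat d :: real^1^1) (- rowvector f) (- columnvector f) A)
     \<longleftrightarrow> transpose A = A \<and> (\<forall>t x. 0 \<le> d * t\<^sup>2 - 2 * t * (f \<bullet> x) + x \<bullet> (A *v x))"
    (is "psd ?B \<longleftrightarrow> _")
proof -
  have "transpose (- rowvector f) = - (columnvector f :: real^1^'n)"
    and "transpose (- columnvector f) = - (rowvector f :: real^'n^1)"
    by (simp_all add: transpose_def rowvector_def columnvector_def vec_eq_iff)
  then have sym: "transpose ?B = ?B \<longleftrightarrow> transpose A = A"
    by (simp add: transpose_block_matrix block_matrix_eq_iff)
  have form: "block_vector p x \<bullet> (?B *v block_vector p x)
      = d * (p $ 1)\<^sup>2 - 2 * (p $ 1) * (f \<bullet> x) + x \<bullet> (A *v x)" for p :: "real^1" and x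
  proof -
    have "mat d *v p = d *\<^sub>R p"
      by (simp add: vec_eq_iff matrix_vector_mult_def mat_def)
    moreover have "(- rowvector f :: real^'n^1) *v x = - vec (f \<bullet> x)"
      by (simp add: vec_eq_iff matrix_vector_mult_def rowvector_def inner_vec_def sum_negf)
    moreover have "- columnvector f *v p = - (p $ 1) *\<^sub>R f"
      by (simp add: vec_eq_iff matrix_vector_mult_def columnvector_def)
    ultimately show ?thesis
      by (simp add: block_matrix_mult_block_vector inner_block_vector inner_add_right
          inner_vec_def[of p] inner_commute[of x f] power2_eq_square algebra_simps)
  qed
  have "(\<forall>z. 0 \<le> z \<bullet> (?B *v z)) \<longleftrightarrow> (\<forall>p x. 0 \<le> block_vector p x \<bullet> (?B *v block_vector p x))"
    by (metis block_vector_cases)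
  also have "\<dots> \<longleftrightarrow> (\<forall>t x. 0 \<le> d * t\<^sup>2 - 2 * t * (f \<bullet> x) + x \<bullet> (A *v x))"
    unfolding form by (metis vec_component)
  finally show ?thesis
    unfolding psd_def sym by blast
qed

section \<open>The Schur complement criterion\<close>

lemma affine_nonneg_imp_slope_zero:
  fixes b c :: real
  assumes "\<And>s. 0 \<le> c - s * b"
  shows "b = 0"
proof (rule ccontr)
  assume "b \<noteq> 0"
  then show False using assms[of "(c + 1) / b"] by simp
qed

theorem psd_bordered_iff_pseudoinverse:
  fixes A :: "real^'n^'n" and f :: "real^'n" and d :: real
  assumes sym: "transpose A = A" and nz: "f \<noteq> 0 \<or> d \<noteq> 0"
  shows "(f \<bullet> (pseudoinverse A *v f) \<le> d \<and> f \<in> range (\<lambda>x. A *v x) \<and> 0 < d \<and> psd A)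
     \<longleftrightarrow> psd (block_matrix (mat d :: real^1^1) (- rowvector f) (- columnvector f) A)"
    (is "?L \<longleftrightarrow> ?R")
proof
  assume L: ?L
  then obtain u where f: "f = A *v u" by auto
  have "A *v (pseudoinverse A *v f) = f"
    using is_pseudoinverse_pseudoinverse[of A]
    by (simp add: f is_pseudoinverse_def matrix_vector_mul_assoc matrix_mul_assoc)
  then have "f \<bullet> (pseudoinverse A *v f) = u \<bullet> (A *v u)"
    by (metis f inner_symmetric_matrix[OF sym])
  then have d: "u \<bullet> (A *v u) \<le> d" using L by simp
  have "0 \<le> d * t\<^sup>2 - 2 * t * (f \<bullet> x) + x \<bullet> (A *v x)" for t x
  proof -
    have "f \<bullet> x = u \<bullet> (A *v x)" "f \<bullet> x = x \<bullet> (A *v u)"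
      using inner_symmetric_matrix[OF sym] by (auto simp: f inner_commute)
    \<comment> \<open>completing the square around \<open>x = t u\<close>\<close>
    then have "d * t\<^sup>2 - 2 * t * (f \<bullet> x) + x \<bullet> (A *v x)
        = (d - u \<bullet> (A *v u)) * t\<^sup>2 + (x - t *\<^sub>R u) \<bullet> (A *v (x - t *\<^sub>R u))"
      by (simp add: matrix_vector_mult_diff_distrib matrix_vector_mult_scaleR inner_diff_left
          inner_diff_right power2_eq_square algebra_simps)
    moreover have "0 \<le> (x - t *\<^sub>R u) \<bullet> (A *v (x - t *\<^sub>R u))"
      using L by (auto simp: psd_def)
    ultimately show ?thesis using d by simp
  qed
  then show ?R using sym by (simp add: psd_bordered_iff)
next
  assume ?R
  then have q: "0 \<le> d * t\<^sup>2 - 2 * t * (f \<bullet> x) + x \<bullet> (A *v x)" for t x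
    by (simp add: psd_bordered_iff)
  have psd: "psd A" using q[of 0] sym by (simp add: psd_def)
  have "0 \<le> d" using q[of 1 0] by simp
  moreover have "d \<noteq> 0"
  proof
    assume "d = 0"
    then have "0 \<le> f \<bullet> (A *v f) - s * (2 * (f \<bullet> f))" for s
      using q[of s f] by (simp add: algebra_simps)
    then have "2 * (f \<bullet> f) = 0" by (rule affine_nonneg_imp_slope_zero)
    then show False using nz \<open>d = 0\<close> by simp
  qed
  ultimately have "0 < d" by simp
  have orth: "f \<bullet> x = 0" if "A *v x = 0" for x
  proof -
    have "0 \<le> d - s * (2 * (f \<bullet> x))" for s
      using q[of 1 "s *\<^sub>R x"] that by (simp add: matrix_vector_mult_scaleR algebra_simps)
    then have "2 * (f \<bullet> x) = 0" by (rule affine_nonneg_imp_slope_zero)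
    then show ?thesis by simp
  qed
  define u where "u = pseudoinverse A *v f"
  have u: "A *v u = f" unfolding u_def by (rule pseudoinverse_solves[OF sym orth])
  then have "f \<bullet> u \<le> d" using q[of 1 u] by (simp add: inner_commute)
  moreover have "f \<in> range (\<lambda>x. A *v x)" using u by blast
  ultimately show ?L using \<open>0 < d\<close> psd by (simp add: u_def)
qed

section \<open>The dynamic stiffness matrix\<close>

lemma transpose_dynamic_stiffness:
  fixes K1 K2 K3 M1 :: "'e::finite \<Rightarrow> real^'n^'n"
  assumes "\<And>e. transpose (K1 e) = K1 e" "\<And>e. transpose (K2 e) = K2 e"
    "\<And>e. transpose (K3 e) = K3 e" "transpose M0 = M0" "\<And>e. transpose (M1 e) = M1 e"
  shows "transpose (dynamic_stiffness K1 K2 K3 M0 M1 \<omega> a) = dynamic_stiffness K1 K2 K3 M0 M1 \<omega> a"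
proof -
  have sym_iff: "transpose M = M \<longleftrightarrow> (\<forall>i j. M $ j $ i = M $ i $ j)" for M :: "real^'n^'n"
    by (simp add: vec_eq_iff transpose_def)
  show ?thesis
    using assms unfolding sym_iff
    by (simp add: dynamic_stiffness_def stiffness_def mass_def)
qed

theorem proposition1:
  fixes K1 K2 K3 M1 :: "'e::finite \<Rightarrow> real^'n^'n"
    and M0 :: "real^'n^'n"
    and a :: "real^'e" and \<omega> d :: real and f :: "real^'n"
  assumes "\<And>e. psd (K1 e)" and "\<And>e. psd (K2 e)" and "\<And>e. psd (K3 e)"
    and "psd M0" and "\<And>e. psd (M1 e)"
    and "\<And>e. 0 \<le> a $ e" and "0 < \<omega>"
    and not_both_zero: "f \<noteq> 0 \<or> d \<noteq> 0"
  shows "(f \<bullet> (pseudoinverse (dynamic_stiffness K1 K2 K3 M0 M1 \<omega> a) *v f) \<le> d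
          \<and> f \<in> range (\<lambda>x. dynamic_stiffness K1 K2 K3 M0 M1 \<omega> a *v x)
          \<and> 0 < d
          \<and> psd (dynamic_stiffness K1 K2 K3 M0 M1 \<omega> a))
     \<longleftrightarrow> psd (block_matrix (mat d :: real^1^1) (- rowvector f)
               (- columnvector f) (dynamic_stiffness K1 K2 K3 M0 M1 \<omega> a))"
proof (rule psd_bordered_iff_pseudoinverse)
  show "transpose (dynamic_stiffness K1 K2 K3 M0 M1 \<omega> a) = dynamic_stiffness K1 K2 K3 M0 M1 \<omega> a"
    using assms by (intro transpose_dynamic_stiffness) (auto simp: psd_def)
qed (fact not_both_zero)

end
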